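(* Let $h\ge 3$ be an integer and let $A=\{a+id:i=0,1,\ldots,h\}$ be an $(h+1)$-term arithmetic progression of positive integers with common difference $d>0$. Then $$\left|h^{\wedge}_{\pm}A\right|\ge\begin{cases}(h+1)^2,& \text{if } d=2\min(A),\\ (h+1)^2+1,&\text{otherwise.}\end{cases}$$ Furthermore, $\left|h^{\wedge}_{\pm}A\right|=(h+1)^2$ if and only if $d=2\min(A)$.
   Context: For a positive integer $h$ and a finite set of integers $A=\{a_1,\ldots,a_k\}$ (distinct elements), the restricted $h$-fold signed sumset is $h^{\wedge}_{\pm}A=\left\{\sum_{i=1}^k\lambda_i a_i:\lambda_i\in\{-1,0,1\},\ \sum_{i=1}^k|\lambda_i|=h\right\}$. *)

theory Defs
  imports Main
begin

text \<open>
  The coefficients \<open>\<lambda>\<^sub>i\<close> are indexed by the elements of \<open>A\<close> themselves, which are distinct;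
  values of \<open>c\<close> outside \<open>A\<close> are irrelevant. The definition is meant for finite \<open>A\<close>.
\<close>
definition restricted_signed_sumset :: "nat \<Rightarrow> int set \<Rightarrow> int set" where
  "restricted_signed_sumset h A =
     {\<Sum>a\<in>A. c a * a | c :: int \<Rightarrow> int. (\<forall>a\<in>A. c a \<in> {-1, 0, 1}) \<and> (\<Sum>a\<in>A. \<bar>c a\<bar>) = int h}"

end

theory Submission
  imports Defs
begin

text \<open>
  A signed sum of \<open>h\<close> of the \<open>h + 1\<close> terms omits one index \<open>j\<close> and is positive on a set \<open>P\<close> of
  \<open>q\<close> indices. For fixed \<open>q\<close> these sums form a progression with difference \<open>d\<close>, whose largest
  element is \<open>U q = (2 q - h) a + d (h (h + 1) / 2 - (h - q)\<^sup>2)\<close>. Since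
  \<open>U (q + 1) - U q = 2 a + d (2 (h - q) - 1)\<close>, the top \<open>2 (h - q)\<close> sums of class \<open>q + 1\<close> exceed
  everything in the classes up to \<open>q\<close>. The \<open>h + 1\<close> sums of class \<open>0\<close> together with these give
  \<open>(h + 1)\<^sup>2\<close> sums. One step below them in class \<open>1\<close> lies a further sum, which coincides with
  an element of class \<open>0\<close> only if \<open>d = 2 a\<close>. Conversely, if \<open>d = 2 a\<close>, every sum is
  \<open>a\<close> times an integer of the parity of \<open>h\<close> and of absolute value at most \<open>h\<^sup>2 + 2 h\<close>.
\<close>

section \<open>Finiteness, and signed sums with one omitted index\<close>

lemma finite_restricted_signed_sumset:
  assumes "finite A"
  shows "finite (restricted_signed_sumset h A)"
proof -
  have "x \<in> {- (\<Sum>a\<in>A. \<bar>a\<bar>)..(\<Sum>a\<in>A. \<bar>a\<bar>)}" if x: "x \<in> restricted_signed_sumset h A" for x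
  proof -
    obtain c where c: "x = (\<Sum>a\<in>A. c a * a)" "\<forall>a\<in>A. c a \<in> {-1, 0, 1::int}"
      using x unfolding restricted_signed_sumset_def by blast
    have "\<bar>x\<bar> \<le> (\<Sum>a\<in>A. \<bar>c a * a\<bar>)"
      unfolding c(1) by (rule sum_abs)
    also have "\<dots> \<le> (\<Sum>a\<in>A. \<bar>a\<bar>)"
      using c(2) by (intro sum_mono) fastforce
    finally show ?thesis by auto
  qed
  then show ?thesis
    by (meson finite_atLeastAtMost_int finite_subset subsetI)
qed

text \<open>Take coefficient 1 on \<open>P\<close>, 0 at \<open>j\<close> and -1 on all other
  indices: subtracting the full sum leaves the terms in \<open>P\<close> to be added twice and the
  term at \<open>j\<close> once.\<close>

lemma signed_sum_mem:
  fixes a d :: int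
  assumes d: "d > 0" and P: "P \<subseteq> {..h}" and j: "j \<le> h" "j \<notin> P"
  shows "2 * (\<Sum>i\<in>P. a + int i * d) + (a + int j * d) - (\<Sum>i\<le>h. a + int i * d)
           \<in> restricted_signed_sumset h ((\<lambda>i. a + int i * d) ` {..h})" (is "?v \<in> _ h (?f ` _)")
proof -
  have inj: "inj_on ?f {..h}"
    using d by (auto simp: inj_on_def)
  define e :: "nat \<Rightarrow> int" where
    "e i = 2 * (if i \<in> P then 1 else 0) + (if i = j then 1 else 0) - 1" for i
  define c where "c x = e (the_inv_into {..h} ?f x)" for x
  have cf: "c (?f i) = e i" if "i \<le> h" for i
    using the_inv_into_f_f[OF inj, of i] that by (simp add: c_def)
  have e: "e i \<in> {-1, 0, 1}" "\<bar>e i\<bar> = 1 - (if i = j then 1 else 0)" for i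
    using j by (auto simp: e_def)
  have "(\<Sum>x\<in>?f ` {..h}. c x * x) = (\<Sum>i\<le>h. e i * ?f i)"
    by (simp add: sum.reindex[OF inj] cf)
  also have "\<dots> = (\<Sum>i\<le>h. 2 * (if i \<in> P then ?f i else 0) + (if i = j then ?f i else 0) - ?f i)"
    by (intro sum.cong) (auto simp: e_def algebra_simps)
  also have "\<dots> = ?v"
    using P j by (simp add: sum.distrib sum_subtractf flip: sum_distrib_left sum.inter_restrict)
      (simp add: Int_absorb1 sum.If_cases)
  finally have 1: "?v = (\<Sum>x\<in>?f ` {..h}. c x * x)" by simp
  have "(\<Sum>x\<in>?f ` {..h}. \<bar>c x\<bar>) = (\<Sum>i\<le>h. \<bar>e i\<bar>)"
    by (simp add: sum.reindex[OF inj] cf)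
  also have "\<dots> = int h"
    using j by (simp add: e(2) sum_subtractf)
  finally have 2: "(\<Sum>x\<in>?f ` {..h}. \<bar>c x\<bar>) = int h" .
  have "\<forall>x\<in>?f ` {..h}. c x \<in> {-1, 0, 1}"
    using cf e(1) by auto
  with 1 2 show ?thesis
    unfolding restricted_signed_sumset_def by blast
qed

section \<open>Index sums attained within one class\<close>

lemma double_sum_atLeastAtMost:
  fixes h n :: nat
  assumes "n \<le> Suc h"
  shows "2 * \<Sum>{n..h} + n * (n - 1) = h * (h + 1)"
  using assms
proof (induction h)
  case 0
  then have "n = 0 \<or> n = 1" by auto
  then show ?case by auto
next
  case (Suc h)
  show ?case
  proof (cases "n = Suc (Suc h)")
    case False
    then have "n \<le> Suc h" using Suc.prems by simp
    then show ?thesis using Suc.IH by simp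
  qed simp
qed

text \<open>
  Replacing \<open>n + 1\<close> by a smaller \<open>m\<close> in the optimal set \<open>{n + 1..h}\<close> reduces the claim to
  \<open>2 m + j = 3 n + 2 - t\<close> with \<open>m \<noteq> j\<close>. The only case not covered is \<open>n = 1\<close>, \<open>t = 2\<close>, where two
  elements have to move; this needs \<open>h \<ge> 3\<close>.
\<close>
lemma top_sums_attained:
  fixes h n q t :: nat
  assumes h: "h \<ge> 3" "q + n = h" "q \<ge> 1" and t: "t \<le> 2 * n + 1 \<or> (n \<ge> 1 \<and> t \<le> 2 * n + 2)"
  shows "\<exists>P j. P \<subseteq> {..h} \<and> card P = q \<and> j \<le> h \<and> j \<notin> P \<and> 2 * \<Sum>P + j + t + n\<^sup>2 = h * (h + 1)"
proof (cases "n = 1 \<and> t = 2")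
  case True
  \<comment> \<open>The optimal set is \<open>{2..h}\<close>; here 3 is omitted and replaced by 1,
    with \<open>j = 3\<close>.\<close>
  define P where "P = insert 1 (insert 2 {4..h})"
  have "2 * \<Sum>{4..h} + 12 = h * (h + 1)"
    using double_sum_atLeastAtMost[of 4 h] h by simp
  then have "P \<subseteq> {..h} \<and> card P = q \<and> 3 \<le> h \<and> 3 \<notin> P \<and> 2 * \<Sum>P + 3 + t + n\<^sup>2 = h * (h + 1)"
    using True h by (auto simp: P_def)
  then show ?thesis by blast
next
  case False
  define r where "r = 3 * n + 2 - t"
  have r: "r + t = 3 * n + 2" "r \<noteq> 0" using t by (auto simp: r_def)
  have "\<exists>m j. m \<le> n + 1 \<and> j \<le> n + 1 \<and> j \<noteq> m \<and> 2 * m + j = r"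
  proof (cases "r \<ge> 2 * n + 2")
    case True
    \<comment> \<open>For large \<open>r\<close> keep the optimal \<open>m = n + 1\<close> and let
      \<open>j\<close> take the remainder.\<close>
    then have "n + 1 \<le> n + 1 \<and> r - 2 * n - 2 \<le> n + 1 \<and> r - 2 * n - 2 \<noteq> n + 1
        \<and> 2 * (n + 1) + (r - 2 * n - 2) = r"
      using r by auto
    then show ?thesis by blast
  next
    case r_small: False
    show ?thesis
    \<comment> \<open>Otherwise \<open>m = r div 2\<close> and \<open>j = r mod 2\<close> work
      unless they coincide, that is, unless \<open>r\<close> is 0 or 3.\<close>
    proof (cases "r = 3")
      case True
      then have "n \<ge> 2" using r False r_small by auto
      with True show ?thesis by (intro exI[of _ 0] exI[of _ 3]) auto
    next
      case False
      have "r div 2 \<noteq> r mod 2" using False r(2) by presburger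
      moreover have "r div 2 \<le> n + 1" "r mod 2 \<le> n + 1"
        using r_small by linarith+
      moreover have "2 * (r div 2) + r mod 2 = r" by simp
      ultimately show ?thesis by metis
    qed
  qed
  then obtain m j where mj: "m \<le> n + 1" "j \<le> n + 1" "j \<noteq> m" "2 * m + j = r" by blast
  define P where "P = insert m {n + 2..h}"
  have "2 * \<Sum>{n + 2..h} + (n + 2) * (n + 1) = h * (h + 1)"
    using double_sum_atLeastAtMost[of "n + 2" h] h by simp
  moreover have "\<Sum>P = m + \<Sum>{n + 2..h}"
    using mj by (simp add: P_def)
  moreover have "(n + 2) * (n + 1) = n\<^sup>2 + (3 * n + 2)"
    by (simp add: power2_eq_square algebra_simps)
  ultimately have "2 * \<Sum>P + j + t + n\<^sup>2 = h * (h + 1)"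
    using mj(4) r by linarith
  moreover have "P \<subseteq> {..h}" "card P = q" "j \<le> h" "j \<notin> P"
    using mj h by (auto simp: P_def)
  ultimately show ?thesis by blast
qed

lemma double_sum_progression:
  fixes a d :: int
  assumes "finite P"
  shows "2 * (\<Sum>i\<in>P. a + int i * d) = 2 * int (card P) * a + int (2 * \<Sum>P) * d"
  by (simp add: sum.distrib sum_distrib_left sum_distrib_right algebra_simps)

text \<open>Here \<open>t\<close> counts steps of size \<open>d\<close> down from the largest sum of
  class \<open>q\<close>. In class 0 the set \<open>P\<close> is empty and
  \<open>j = h - t\<close>.\<close>

lemma class_sum_mem:
  fixes a d T :: int
  assumes d: "d > 0" and T: "2 * T = int (h * (h + 1))"
    and h: "h \<ge> 3" "q \<le> h"
    and t: "if q = 0 then t \<le> h else t < 2 * (h - q + 1) \<or> (q < h \<and> t \<le> 2 * (h - q + 1))"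
  shows "(2 * int q - int h) * a + d * (T - (int h - int q)\<^sup>2) - int t * d
           \<in> restricted_signed_sumset h ((\<lambda>i. a + int i * d) ` {..h})"
proof -
  have "\<exists>P j. P \<subseteq> {..h} \<and> card P = q \<and> j \<le> h \<and> j \<notin> P
          \<and> 2 * \<Sum>P + j + t + (h - q)\<^sup>2 = h * (h + 1)"
  proof (cases "q = 0")
    case True
    then have "(h - t) + t + (h - q)\<^sup>2 = h * (h + 1)"
      using t by (simp add: power2_eq_square)
    with True show ?thesis
      by (intro exI[of _ "{}"] exI[of _ "h - t"]) auto
  next
    case False
    with h t show ?thesis
      by (intro top_sums_attained) auto
  qed
  then obtain P j where P: "P \<subseteq> {..h}" "card P = q" "j \<le> h" "j \<notin> P"
    and s: "2 * \<Sum>P + j + t + (h - q)\<^sup>2 = h * (h + 1)" by blast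
  have "int (2 * \<Sum>P) + int j + int t + (int h - int q)\<^sup>2 = 2 * T"
    using arg_cong[OF s, of int] T h(2) by (simp add: of_nat_diff)
  then have S: "int (2 * \<Sum>P) = 2 * T - int j - int t - (int h - int q)\<^sup>2"
    by simp
  have "2 * \<Sum>{..h} = h * (h + 1)"
    using double_sum_atLeastAtMost[of 0 h] by (simp add: atMost_atLeast0)
  then have all: "2 * (\<Sum>i\<le>h. a + int i * d) = 2 * (int h + 1) * a + 2 * T * d"
    using T by (subst double_sum_progression) auto
  have "finite P" using P(1) finite_subset by blast
  then have "2 * (\<Sum>i\<in>P. a + int i * d)
      = 2 * int q * a + (2 * T - int j - int t - (int h - int q)\<^sup>2) * d"
    by (simp only: double_sum_progression P(2) S)
  with all have "2 * (\<Sum>i\<in>P. a + int i * d) + (a + int j * d) - (\<Sum>i\<le>h. a + int i * d)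
      = (2 * int q - int h) * a + d * (T - (int h - int q)\<^sup>2) - int t * d"
    by (simp add: algebra_simps)
  with signed_sum_mem[OF d P(1,3,4), of a] show ?thesis by simp
qed

section \<open>Lower bound, by counting class after class\<close>

lemma card_restricted_signed_sumset_ge:
  fixes a d :: int
  assumes h: "h \<ge> 3" and d: "d > 0" and a: "a > 0"
  shows "card (restricted_signed_sumset h ((\<lambda>i. a + int i * d) ` {..h}))
           \<ge> (h + 1)\<^sup>2 + (if d = 2 * a then 0 else 1)"
proof -
  define R where "R = restricted_signed_sumset h ((\<lambda>i. a + int i * d) ` {..h})"
  define e :: nat where "e = (if d = 2 * a then 0 else 1)"
  define T :: int where "T = int (h * (h + 1) div 2)"
  have "even (h * (h + 1))" by auto
  then have T: "2 * T = int (h * (h + 1))"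
    unfolding T_def by (metis dvd_mult_div_cancel of_nat_mult of_nat_numeral)
  define U where "U q = (2 * int q - int h) * a + d * (T - (int h - int q)\<^sup>2)" for q :: nat
  have U_Suc: "U (Suc q) = U q + 2 * a + (2 * (int h - int q) - 1) * d" for q
    by (simp add: U_def algebra_simps power2_eq_square)
  have fin: "finite R"
    unfolding R_def by (intro finite_restricted_signed_sumset) simp
  have mem: "U q - int t * d \<in> R"
    if "q \<le> h" "if q = 0 then t \<le> h else t < 2 * (h - q + 1) \<or> (q < h \<and> t \<le> 2 * (h - q + 1))"
    for q t
    using class_sum_mem[OF d T h that, of a] by (simp add: R_def U_def)
  define F where "F q = {x \<in> R. x \<le> U q}" for q
  have finF: "finite (F q)" for q using fin by (simp add: F_def)
  have inj: "inj_on (\<lambda>t. U q - int t * d) X" for q X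
    using d by (auto simp: inj_on_def)
  have le: "U q - int t * d \<le> U q" for q t
    using d by simp
  \<comment> \<open>Class 0 gives \<open>h + 1\<close> elements, each class \<open>i + 1\<close>
    with \<open>i < q\<close> gives \<open>2 * (h - i)\<close> new ones, and class 1 gives
    \<open>e\<close> more. The term \<open>q * (q - 1)\<close> is moved to the right to avoid
    subtraction.\<close>
  have count: "h + 1 + 2 * h * q + e \<le> card (F q) + q * (q - 1)" if "1 \<le> q" "q \<le> h" for q
    using that
  proof (induction q rule: nat_induct_at_least)
    case base
    define X where "X = (\<lambda>t. U 0 - int t * d) ` {..h}"
    define Y where "Y = (\<lambda>t. U 1 - int t * d) ` {..<2 * h + e}"
    have "X \<inter> Y = {}"
    proof (rule ccontr)
      assume "X \<inter> Y \<noteq> {}"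
      then obtain s t where st: "t < 2 * h + e" "U 0 - int s * d = U 1 - int t * d"
        unfolding X_def Y_def by auto
      then have eq: "2 * a = (int t - 2 * int h + 1 - int s) * d"
        using U_Suc[of 0] by (simp add: algebra_simps)
      with a d have "int t - 2 * int h + 1 - int s > 0"
        by (metis mult_pos_pos zero_less_mult_pos2 zero_less_numeral)
      \<comment> \<open>The positive factor of \<open>d\<close> is at most \<open>e\<close>, as
        \<open>t \<le> 2 * h + e - 1\<close>. So it is 1 and \<open>d = 2 * a\<close>, contrary to
        \<open>e = 1\<close>.\<close>
      with st(1) have "e = 1 \<and> int t - 2 * int h + 1 - int s = 1"
        by (auto simp: e_def split: if_splits)
      with eq show False by (simp add: e_def split: if_splits)
    qed
    moreover have "card X = h + 1" "card Y = 2 * h + e"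
      unfolding X_def Y_def by (simp_all add: card_image inj)
    moreover have "finite X" "finite Y" by (simp_all add: X_def Y_def)
    ultimately have card_XY: "card (X \<union> Y) = h + 1 + 2 * h + e"
      by (simp add: card_Un_disjoint)
    have "U 0 \<le> U 1"
      using U_Suc[of 0] a d h by simp
    then have "U 0 - int t * d \<le> U 1" for t
      using le order_trans by blast
    then have "X \<subseteq> F 1"
      using mem[of 0] by (auto simp: X_def F_def)
    moreover have "U 1 - int t * d \<in> R" if "t < 2 * h + e" for t
      using mem[of 1 t] that h by (auto simp: e_def split: if_splits)
    then have "Y \<subseteq> F 1"
      using le[of 1] by (auto simp: Y_def F_def)
    ultimately have "X \<union> Y \<subseteq> F 1" by simp
    then have "card (X \<union> Y) \<le> card (F 1)"
      by (intro card_mono finF)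
    with card_XY show ?case by simp
  next
    case (Suc q)
    define Y where "Y = (\<lambda>t. U (Suc q) - int t * d) ` {..<2 * (h - q)}"
    have above: "x > U q" if "x \<in> Y" for x
    proof -
      obtain t where t: "t < 2 * (h - q)" "x = U (Suc q) - int t * d"
        using \<open>x \<in> Y\<close> by (auto simp: Y_def)
      have "int t \<le> 2 * (int h - int q) - 1"
        using t(1) Suc.prems by auto
      then have "int t * d \<le> (2 * (int h - int q) - 1) * d"
        using d by (intro mult_right_mono) auto
      with t(2) U_Suc[of q] a show ?thesis by simp
    qed
    have "U q \<le> U (Suc q)"
      using U_Suc[of q] a d Suc.prems by simp
    then have "F q \<union> Y \<subseteq> F (Suc q)"
      using le[of "Suc q"] mem[of "Suc q"] Suc.prems
      by (auto simp: Y_def F_def Suc_diff_Suc)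
    then have "card (F q \<union> Y) \<le> card (F (Suc q))"
      by (intro card_mono finF)
    moreover have "F q \<inter> Y = {}"
      using above by (force simp: F_def)
    moreover have "card Y = 2 * (h - q)" "finite Y"
      unfolding Y_def by (simp_all add: card_image inj)
    ultimately have "card (F q) + 2 * (h - q) \<le> card (F (Suc q))"
      using finF by (simp add: card_Un_disjoint)
    moreover have "Suc q * (Suc q - 1) = q * (q - 1) + 2 * q"
      using Suc.hyps by (cases q) auto
    ultimately show ?case
      using Suc.IH Suc.prems by simp
  qed
  have "h + 1 + 2 * h * h + e \<le> card (F h) + h * (h - 1)"
    using count[of h] h by simp
  moreover have "h + 1 + 2 * h * h = (h + 1)\<^sup>2 + h * (h - 1)"
    using h by (cases h) (auto simp: power2_eq_square)
  ultimately have "(h + 1)\<^sup>2 + e \<le> card (F h)" by linarith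
  also have "\<dots> \<le> card R"
    using fin by (intro card_mono) (auto simp: F_def)
  finally show ?thesis by (simp add: R_def e_def)
qed

section \<open>Upper bound when \<open>d = 2 * a\<close>\<close>

lemma card_restricted_signed_sumset_le:
  fixes a :: int
  assumes a: "a > 0"
  shows "card (restricted_signed_sumset h ((\<lambda>i. a + int i * (2 * a)) ` {..h})) \<le> (h + 1)\<^sup>2"
proof -
  define A where "A = (\<lambda>i. a + int i * (2 * a)) ` {..h}"
  define K where "K = (int h + 1)\<^sup>2 - 1"
  have inj: "inj_on (\<lambda>i. a + int i * (2 * a)) {..h}"
    using a by (auto simp: inj_on_def)
  have "(\<Sum>i\<le>h. a + int i * (2 * a)) = a * (int h + 1)\<^sup>2"
    by (induction h) (auto simp: power2_eq_square algebra_simps)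
  then have sumA: "(\<Sum>x\<in>A. x) = a * (int h + 1)\<^sup>2"
    by (simp add: A_def sum.reindex[OF inj])
  have cardA: "card A = h + 1"
    by (simp add: A_def card_image[OF inj])
  have "x \<in> (\<lambda>m. a * (2 * m - K)) ` {0..K}" if x: "x \<in> restricted_signed_sumset h A" for x
  proof -
    obtain c where c: "x = (\<Sum>y\<in>A. c y * y)" "\<forall>y\<in>A. c y \<in> {-1, 0, 1::int}"
        "(\<Sum>y\<in>A. \<bar>c y\<bar>) = int h"
      using x unfolding restricted_signed_sumset_def by blast
    have A: "\<exists>i. y = a + int i * (2 * a)" "a \<le> y" if "y \<in> A" for y
      using that a by (auto simp: A_def)
    have "\<bar>x\<bar> \<le> (\<Sum>y\<in>A. \<bar>c y * y\<bar>)"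
      unfolding c(1) by (rule sum_abs)
    \<comment> \<open>An omitted term costs at least \<open>a\<close>, the least element of
      \<open>A\<close>.\<close>
    also have "\<dots> \<le> (\<Sum>y\<in>A. y - (1 - \<bar>c y\<bar>) * a)"
      using c(2) A(2) a by (intro sum_mono) force
    also have "\<dots> = a * K"
      by (simp add: sum_subtractf sumA cardA c(3) K_def flip: sum_distrib_right)
        (simp add: algebra_simps)
    finally have bound: "\<bar>x\<bar> \<le> a * K" .
    \<comment> \<open>Each \<open>y\<close> is an odd multiple of \<open>a\<close>, and
      \<open>c y\<close> and its absolute value have equal parity, so \<open>x\<close> is congruent
      to \<open>h * a\<close> modulo \<open>2 * a\<close>.\<close>
    have "2 * a dvd (\<Sum>y\<in>A. c y * y - \<bar>c y\<bar> * a)"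
    proof (rule dvd_sum)
      fix y assume "y \<in> A"
      then obtain i where "y = a + int i * (2 * a)" using A by blast
      moreover have "even (c y - \<bar>c y\<bar>)" by simp
      then obtain k where "c y - \<bar>c y\<bar> = 2 * k" by blast
      then have "c y * a - \<bar>c y\<bar> * a = 2 * k * a"
        by (metis left_diff_distrib)
      ultimately have "c y * y - \<bar>c y\<bar> * a = 2 * a * (k + c y * int i)"
        by (simp add: algebra_simps)
      then show "2 * a dvd c y * y - \<bar>c y\<bar> * a" by simp
    qed
    then have "2 * a dvd x - int h * a"
      by (simp add: sum_subtractf c(1) c(3) flip: sum_distrib_right)
    then obtain k where k: "x = int h * a + 2 * a * k"
      by (metis add.commute diff_add_cancel dvdE)
    \<comment> \<open>As \<open>K\<close> is \<open>h * (h + 2)\<close>, it has the parity of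
      \<open>h\<close>; this turns the congruence into the parametrization by
      \<open>m = k + l\<close>, which has \<open>K + 1\<close> values.\<close>
    have "even (int h + K)"
      by (simp add: K_def)
    then obtain l where l: "int h + K = 2 * l" by blast
    have h: "int h = 2 * l - K" using l by simp
    have x: "x = a * (2 * (k + l) - K)"
      unfolding k h by (simp add: algebra_simps)
    have "\<bar>2 * (k + l) - K\<bar> \<le> K"
      using bound a by (simp add: x abs_mult)
    then have "k + l \<in> {0..K}" by auto
    with x show ?thesis by blast
  qed
  then have "card (restricted_signed_sumset h A) \<le> card ((\<lambda>m. a * (2 * m - K)) ` {0..K})"
    by (intro card_mono) auto
  also have "\<dots> \<le> card {0..K}"
    by (intro card_image_le) simp
  also have "\<dots> = (h + 1)\<^sup>2"
    by (simp add: K_def nat_power_eq nat_add_distrib)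
  finally show ?thesis by (simp add: A_def)
qed

theorem theorem2p4:
  fixes h :: nat and a d :: int and A :: "int set"
  assumes "h \<ge> 3"
    and "d > 0"
    and "A = {a + int i * d | i. i \<in> {0..h}}"
    and "\<forall>x\<in>A. x > 0"
  shows "card (restricted_signed_sumset h A) \<ge>
           (if d = 2 * Min A then (h + 1)\<^sup>2 else (h + 1)\<^sup>2 + 1) \<and>
         (card (restricted_signed_sumset h A) = (h + 1)\<^sup>2 \<longleftrightarrow> d = 2 * Min A)"
proof -
  have A: "A = (\<lambda>i. a + int i * d) ` {..h}"
    using assms(3) by auto
  have "a \<in> A" unfolding A by (rule image_eqI[of _ _ 0]) auto
  then have a: "a > 0" using assms(4) by blast
  have "Min A = a"
    using \<open>a \<in> A\<close> assms(2) by (intro Min_eqI) (auto simp: A)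
  moreover note card_restricted_signed_sumset_ge[OF assms(1,2) a, folded A]
  moreover have "card (restricted_signed_sumset h A) \<le> (h + 1)\<^sup>2" if "d = 2 * a"
    using card_restricted_signed_sumset_le[OF a, of h] that by (simp add: A)
  ultimately show ?thesis by (auto split: if_splits)
qed

end
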